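(* Let $H$ be a (not necessarily semibounded) self-adjoint operator with bounded inverse in a Hilbert space $\mathcal{H}$, let $\mathcal{U}$ be a finite dimensional subspace of $\operatorname{Dom}(H)$, put $\mathcal{V} = \operatorname{Ran} H|_{\mathcal{U}}$ and $\mathcal{W} = \operatorname{Ran} H^{-1}|_{\mathcal{U}}$, and let $P$ be the projection in $\mathcal{H}$ onto $\mathcal{V}$ along the orthogonal complement $\mathcal{W}^\perp$ of $\mathcal{W}$. Then $$\lVert P_{\mathcal{U}} - P \rVert \leq \min\bigl\{ \sin\theta(\mathcal{U},\mathcal{V}), \sin\theta(\mathcal{U},\mathcal{W}) \bigr\} + \tan\theta(\mathcal{V},\mathcal{W}).$$
   Context: For a closed subspace $\mathcal{M}$ of $\mathcal{H}$, $P_{\mathcal{M}}$ denotes the orthogonal projection onto $\mathcal{M}$. The maximal angle between two closed subspaces $\mathcal{M}$ and $\mathcal{N}$ of $\mathcal{H}$ is $\theta(\mathcal{M},\mathcal{N}) = \arcsin(\lVert P_{\mathcal{M}} - P_{\mathcal{N}} \rVert)$. $\operatorname{Ran} H|_{\mathcal{U}} = \{Hu : u \in \mathcal{U}\}$ and $\operatorname{Ran} H^{-1}|_{\mathcal{U}} = \{H^{-1}u : u \in \mathcal{U}\}$. The projection $P$ (in general non-orthogonal, with range $\mathcal{V}$ and kernel $\mathcal{W}^\perp$) always exists and is given by $P = H P_{\mathcal{U}} H^{-1}$. In this setting $\lVert P_{\mathcal{V}} - P_{\mathcal{W}} \rVert < 1$, so $\tan\theta(\mathcal{V},\mathcal{W})$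 is finite. *)

theory Defs
  imports "HOL-Analysis.Analysis"
begin

class complex_vector = real_vector +
  fixes scaleC :: "complex \<Rightarrow> 'a \<Rightarrow> 'a"  (infixr "*\<^sub>C" 75)
  assumes scaleC_add_right: "a *\<^sub>C (x + y) = a *\<^sub>C x + a *\<^sub>C y"
    and scaleC_add_left: "(a + b) *\<^sub>C x = a *\<^sub>C x + b *\<^sub>C x"
    and scaleC_scaleC: "a *\<^sub>C (b *\<^sub>C x) = (a * b) *\<^sub>C x"
    and scaleC_one: "1 *\<^sub>C x = x"
    and scaleR_scaleC: "r *\<^sub>R x = complex_of_real r *\<^sub>C x"

text \<open>
  The complex inner product is linear in its second argument.  Its real part is the inner
  product of \<^class>\<open>real_inner\<close>, so that norm and topology are those of the library, and
  positive definiteness is inherited.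
\<close>

class complex_inner = complex_vector + real_inner +
  fixes cinner :: "'a \<Rightarrow> 'a \<Rightarrow> complex"
  assumes cinner_commute: "cinner x y = cnj (cinner y x)"
    and cinner_add_right: "cinner x (y + z) = cinner x y + cinner x z"
    and cinner_scaleC_right: "cinner x (a *\<^sub>C y) = a * cinner x y"
    and inner_Re_cinner: "inner x y = Re (cinner x y)"

class chilbert_space = complex_inner + complete_space

global_interpretation complex_vector: vector_space "scaleC :: complex \<Rightarrow> 'a \<Rightarrow> 'a::complex_vector"
  defines csubspace = complex_vector.subspace
    and cspan = complex_vector.span
  by unfold_locales
    (simp_all add: scaleC_add_right scaleC_add_left scaleC_scaleC scaleC_one)

definition finite_dim_csubspace :: "'a::complex_vector set \<Rightarrow> bool" where
  "finite_dim_csubspace U \<longleftrightarrow> csubspace U \<and> (\<exists>B. finite B \<and> U = cspan B)"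

definition orthocomplement :: "'a::complex_inner set \<Rightarrow> 'a set" where
  "orthocomplement M = {x. \<forall>y\<in>M. cinner y x = 0}"

text \<open>
  The projection onto \<open>V\<close> along \<open>K\<close> (with range \<open>V\<close> and kernel \<open>K\<close>); it is meaningful
  when the whole space is the direct sum of \<open>V\<close> and \<open>K\<close>.
\<close>

definition proj_along :: "'a::complex_vector set \<Rightarrow> 'a set \<Rightarrow> 'a \<Rightarrow> 'a" where
  "proj_along V K x = (THE v. v \<in> V \<and> x - v \<in> K)"

definition orthproj :: "'a::complex_inner set \<Rightarrow> 'a \<Rightarrow> 'a" where
  "orthproj M = proj_along M (orthocomplement M)"

definition max_angle :: "'a::complex_inner set \<Rightarrow> 'a set \<Rightarrow> real" where
  "max_angle M N = arcsin (onorm (\<lambda>x. orthproj M x - orthproj N x))"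

text \<open>
  An unbounded operator is given by its domain \<open>D\<close> and a total function \<open>H\<close> whose values
  outside \<open>D\<close> are irrelevant.
\<close>

definition operator_on :: "'a::complex_vector set \<Rightarrow> ('a \<Rightarrow> 'a) \<Rightarrow> bool" where
  "operator_on D H \<longleftrightarrow> csubspace D
     \<and> (\<forall>x\<in>D. \<forall>y\<in>D. H (x + y) = H x + H y)
     \<and> (\<forall>c. \<forall>x\<in>D. H (c *\<^sub>C x) = c *\<^sub>C H x)"

definition adjoint_dom :: "'a::complex_inner set \<Rightarrow> ('a \<Rightarrow> 'a) \<Rightarrow> 'a set" where
  "adjoint_dom D H = {y. \<exists>z. \<forall>x\<in>D. cinner (H x) y = cinner x z}"

text \<open>The adjoint is well defined on \<open>adjoint_dom D H\<close> when \<open>D\<close> is dense.\<close>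

definition adjoint_op :: "'a::complex_inner set \<Rightarrow> ('a \<Rightarrow> 'a) \<Rightarrow> 'a \<Rightarrow> 'a" where
  "adjoint_op D H y = (THE z. \<forall>x\<in>D. cinner (H x) y = cinner x z)"

definition selfadjoint :: "'a::complex_inner set \<Rightarrow> ('a \<Rightarrow> 'a) \<Rightarrow> bool" where
  "selfadjoint D H \<longleftrightarrow> operator_on D H \<and> closure D = UNIV
     \<and> adjoint_dom D H = D \<and> (\<forall>y\<in>D. adjoint_op D H y = H y)"

text \<open>
  The inverse of \<open>H\<close> maps the whole space onto the domain \<open>D\<close>.  Real linearity in
  \<^const>\<open>bounded_linear\<close> entails complex linearity here, as \<open>H\<close> is complex linear on \<open>D\<close>.
\<close>

definition has_bounded_inverse :: "'a::complex_inner set \<Rightarrow> ('a \<Rightarrow> 'a) \<Rightarrow> bool" where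
  "has_bounded_inverse D H \<longleftrightarrow> bij_betw H D UNIV \<and> bounded_linear (inv_into D H)"

end

theory Submission
  imports Defs
begin

text \<open>
  Let \<open>p\<close>, \<open>q\<close> be the orthogonal projections onto \<open>V\<close>, \<open>W\<close> and \<open>s = \<parallel>p - q\<parallel> = sin \<theta>(V, W)\<close>.
  Inserting \<open>p\<close>, respectively \<open>q\<close>, between \<open>P\<^sub>U\<close> and \<open>P\<close>, the triangle inequality reduces the claim
  to \<open>\<parallel>p - P\<parallel> \<le> tan \<theta>(V, W)\<close> and \<open>\<parallel>q - P\<parallel> \<le> tan \<theta>(V, W)\<close>.  Both estimates rest on the fact that
  a vector \<open>v \<in> V\<close> is at distance at most \<open>s\<parallel>v\<parallel>\<close> from \<open>W\<close>, whence
  \<open>\<parallel>v\<parallel> \<le> \<parallel>q v\<parallel> / \<surd>(1 - s\<^sup>2)\<close> by Pythagoras (\<open>norm_le_orthproj_div_cos\<close>).  This is applied to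
  vectors \<open>v\<close> in the range of \<open>P\<close>, for which \<open>q v\<close> is controlled because \<open>P\<close> moves each vector
  along \<open>W\<^sup>\<bottom>\<close>, the kernel of \<open>q\<close>.

  All of this presupposes \<open>s < 1\<close>, and that is where the operator enters
  (\<open>onorm_orthproj_diff_less_1\<close>).  By symmetry of \<open>H\<inverse>\<close>, the projection \<open>P\<close> exists and equals
  \<open>H P\<^sub>U H\<inverse>\<close>, a bounded operator since \<open>H P\<^sub>U\<close> has finite rank and \<open>P\<^sub>U\<close> is a finite sum of
  rank-one projections.  Boundedness of \<open>P\<close> says that \<open>q\<close> is bounded below on \<open>V\<close> and \<open>p\<close> on \<open>W\<close>,
  and then \<open>p - q\<close> is a strict contraction.

  The angles and norms only involve the real part of the inner product.  Orthogonality to a complex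
  subspace is the same for the complex and the real inner product, so the geometry is carried out
  in real inner product spaces.
\<close>

section \<open>Orthogonal projections in real inner product spaces\<close>

text \<open>
  A predicate on functions instead of an operator on subspaces: an inner product space need not be
  complete, so existence of a projection is a property of \<open>M\<close> and is part of the predicate.
\<close>

definition is_orthproj :: "'a::real_inner set \<Rightarrow> ('a \<Rightarrow> 'a) \<Rightarrow> bool" where
  "is_orthproj M p \<longleftrightarrow> subspace M \<and> (\<forall>x. p x \<in> M \<and> (\<forall>y\<in>M. y \<bullet> (x - p x) = 0))"

context
  fixes M :: "'a::real_inner set" and p :: "'a \<Rightarrow> 'a"
  assumes p: "is_orthproj M p"
begin

lemma orthproj_subspace: "subspace M"
  and orthproj_in: "p x \<in> M"
  and orthproj_orth: "y \<in> M \<Longrightarrow> y \<bullet> (x - p x) = 0"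
  using p by (auto simp: is_orthproj_def)

lemma orthproj_unique:
  assumes "m \<in> M" "\<And>y. y \<in> M \<Longrightarrow> y \<bullet> (x - m) = 0"
  shows "p x = m"
proof -
  have d: "p x - m \<in> M" using orthproj_in assms orthproj_subspace by (auto intro: subspace_diff)
  have "(p x - m) \<bullet> (p x - m) = (p x - m) \<bullet> (x - m) - (p x - m) \<bullet> (x - p x)"
    by (simp add: inner_diff_right)
  also have "\<dots> = 0" using assms(2)[OF d] orthproj_orth[OF d] by simp
  finally show ?thesis by simp
qed

lemma orthproj_fixes: "m \<in> M \<Longrightarrow> p m = m"
  by (rule orthproj_unique) auto

lemma orthproj_cong:
  assumes "\<And>w. w \<in> M \<Longrightarrow> w \<bullet> (x - y) = 0"
  shows "p x = p y"
proof (rule orthproj_unique[OF orthproj_in])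
  fix w assume w: "w \<in> M"
  show "w \<bullet> (x - p y) = 0"
    using assms[OF w] orthproj_orth[OF w, of y] by (simp add: inner_diff_right)
qed

lemma orthproj_pythagoras: "(norm x)\<^sup>2 = (norm (p x))\<^sup>2 + (norm (x - p x))\<^sup>2"
  using orthproj_orth[OF orthproj_in, of x x]
  by (simp add: power2_norm_eq_inner inner_diff_left inner_diff_right inner_commute)

lemma orthproj_norm_le: "norm (p x) \<le> norm x" "norm (x - p x) \<le> norm x"
  by (rule power2_le_imp_le; use orthproj_pythagoras[of x] in simp)+

lemma orthproj_bounded_linear: "bounded_linear p"
proof (rule bounded_linear_intro[where K = 1])
  fix x y and r :: real
  show "p (x + y) = p x + p y"
  proof (rule orthproj_unique)
    show "p x + p y \<in> M" by (intro subspace_add orthproj_subspace orthproj_in)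
    show "w \<bullet> (x + y - (p x + p y)) = 0" if "w \<in> M" for w
      using orthproj_orth[OF that, of x] orthproj_orth[OF that, of y]
      by (simp add: inner_diff_right inner_add_right)
  qed
  show "p (r *\<^sub>R x) = r *\<^sub>R p x"
  proof (rule orthproj_unique)
    show "r *\<^sub>R p x \<in> M" by (intro subspace_scale orthproj_subspace orthproj_in)
    show "w \<bullet> (r *\<^sub>R x - r *\<^sub>R p x) = 0" if "w \<in> M" for w
      using orthproj_orth[OF that, of x] by (simp add: inner_diff_right)
  qed
  show "norm (p x) \<le> norm x * 1" using orthproj_norm_le by simp
qed

end

text \<open>
  The vector \<open>0\<close> may belong to \<open>C\<close>; its term vanishes.
\<close>

lemma is_orthproj_orthogonal_sum:
  fixes C :: "'a::real_inner set"
  assumes "finite C" "pairwise orthogonal C"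
  shows "is_orthproj (span C) (\<lambda>x. \<Sum>b\<in>C. (b \<bullet> x / (b \<bullet> b)) *\<^sub>R b)"
    (is "is_orthproj _ ?p")
  unfolding is_orthproj_def
proof (intro conjI allI ballI)
  fix x y
  show "?p x \<in> span C" by (intro span_sum span_scale span_base)
  assume "y \<in> span C"
  then show "y \<bullet> (x - ?p x) = 0"
  proof (induction rule: span_induct)
    case base
    show ?case by (auto simp: subspace_def inner_add_left)
  next
    case (step b)
    have "b \<bullet> ?p x = (\<Sum>c\<in>C. if c = b then b \<bullet> x else 0)"
      unfolding inner_sum_right
      using assms(2) step
      by (intro sum.cong refl) (auto simp: pairwise_def orthogonal_def)
    then show ?case using assms(1) step by (simp add: inner_diff_right)
  qed
qed simp

lemma finite_span_orthproj:
  fixes B :: "'a::real_inner set"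
  assumes "finite B"
  obtains C where
    "is_orthproj (span B) (\<lambda>x. \<Sum>b\<in>C. (b \<bullet> x / (b \<bullet> b)) *\<^sub>R b)"
proof -
  obtain C where C: "finite C" "span C = span B" "pairwise orthogonal C"
    using basis_orthogonal[OF assms] by blast
  show ?thesis
    using that is_orthproj_orthogonal_sum[OF C(1,3)] unfolding C(2) .
qed

text \<open>
  An operator that factors through the projection onto a finite-dimensional space is a finite sum of
  the rank-one operators \<open>x \<mapsto> (b \<bullet> x / (b \<bullet> b)) T b\<close>.
\<close>

lemma bounded_linear_via_finite_span:
  fixes B :: "'a::real_inner set" and T :: "'a \<Rightarrow> 'b::real_normed_vector"
  assumes B: "finite B" and T: "linear T" and p: "is_orthproj (span B) p"
    and Tp: "\<And>x. T (p x) = T x"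
  shows "bounded_linear T"
proof -
  obtain C where q_proj:
      "is_orthproj (span B) (\<lambda>x. \<Sum>b\<in>C. (b \<bullet> x / (b \<bullet> b)) *\<^sub>R b)"
    by (rule finite_span_orthproj[OF B])
  define q where "q = (\<lambda>x. \<Sum>b\<in>C. (b \<bullet> x / (b \<bullet> b)) *\<^sub>R b)"
  have "q x = p x" for x
    unfolding q_def
    by (rule orthproj_unique[OF q_proj orthproj_in[OF p] orthproj_orth[OF p]])
  then have "T x = T (q x)" for x using Tp[of x] by simp
  then have "T = (\<lambda>x. \<Sum>b\<in>C. (b \<bullet> x / (b \<bullet> b)) *\<^sub>R T b)"
    unfolding q_def linear_sum[OF T] linear_scale[OF T] by blast
  moreover have "bounded_linear (\<lambda>x. (b \<bullet> x / (b \<bullet> b)) *\<^sub>R T b)" for b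
    unfolding divide_inverse
    by (rule bounded_linear_scaleR_const[OF bounded_linear_mult_const[OF bounded_linear_inner_right]])
  then have "bounded_linear (\<lambda>x. \<Sum>b\<in>C. (b \<bullet> x / (b \<bullet> b)) *\<^sub>R T b)"
    by (rule bounded_linear_sum)
  ultimately show ?thesis by simp
qed

section \<open>The difference of two orthogonal projections\<close>

context
  fixes V W :: "'a::real_inner set" and p q :: "'a \<Rightarrow> 'a"
  assumes p: "is_orthproj V p" and q: "is_orthproj W q"
begin

lemma orthproj_diff_bounded_linear: "bounded_linear (\<lambda>x. p x - q x)"
  by (intro bounded_linear_sub orthproj_bounded_linear[OF p] orthproj_bounded_linear[OF q])

text \<open>
  Writing \<open>p - q = p (1 - q) - (1 - p) q\<close> splits the difference into a part in \<open>V\<close> and a part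
  orthogonal to \<open>V\<close>.
\<close>

lemma norm_orthproj_diff:
  "(norm (p x - q x))\<^sup>2 = (norm (p (x - q x)))\<^sup>2 + (norm (q x - p (q x)))\<^sup>2"
proof -
  interpret p: bounded_linear p by (rule orthproj_bounded_linear[OF p])
  have "p x - q x = p (x - q x) - (q x - p (q x))" by (simp add: p.diff)
  moreover have "p (x - q x) \<bullet> (q x - p (q x)) = 0"
    by (rule orthproj_orth[OF p orthproj_in[OF p]])
  moreover have "(norm (a - b))\<^sup>2 = (norm a)\<^sup>2 + (norm b)\<^sup>2" if "a \<bullet> b = 0" for a b :: 'a
    using that by (simp add: power2_norm_eq_inner inner_diff_left inner_diff_right inner_commute)
  ultimately show ?thesis by metis
qed

lemma onorm_orthproj_diff_le_1: "onorm (\<lambda>x. p x - q x) \<le> 1"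
proof (rule onorm_bound)
  fix x
  have "(norm (p x - q x))\<^sup>2 \<le> (norm (x - q x))\<^sup>2 + (norm (q x))\<^sup>2"
    unfolding norm_orthproj_diff
    by (intro add_mono power_mono orthproj_norm_le[OF p]) auto
  also have "\<dots> = (norm x)\<^sup>2" using orthproj_pythagoras[OF q, of x] by simp
  finally show "norm (p x - q x) \<le> 1 * norm x" by (simp add: power2_le_iff_abs_le)
qed simp

lemma sin_arcsin_onorm_orthproj_diff:
  "sin (arcsin (onorm (\<lambda>x. p x - q x))) = onorm (\<lambda>x. p x - q x)"
  using onorm_orthproj_diff_le_1 onorm_pos_le[OF orthproj_diff_bounded_linear] by simp

lemma tan_arcsin_onorm_orthproj_diff:
  assumes less1: "onorm (\<lambda>x. p x - q x) < 1"
  shows "tan (arcsin (onorm (\<lambda>x. p x - q x)))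
     = onorm (\<lambda>x. p x - q x) / sqrt (1 - (onorm (\<lambda>x. p x - q x))\<^sup>2)"
  using less1 onorm_pos_le[OF orthproj_diff_bounded_linear] by (simp add: tan_def cos_arcsin)

text \<open>
  A vector of \<open>V\<close> makes an angle of at most \<open>\<theta>(V, W)\<close> with its projection to \<open>W\<close>, and the denominator
  is the cosine of that angle.
\<close>

lemma norm_le_orthproj_div_cos:
  assumes less1: "onorm (\<lambda>x. p x - q x) < 1"
    and v: "v \<in> V"
  shows "norm v \<le> norm (q v) / sqrt (1 - (onorm (\<lambda>x. p x - q x))\<^sup>2)"
proof -
  define s where "s = onorm (\<lambda>x. p x - q x)"
  have s: "0 \<le> s" "s < 1" using less1 onorm_pos_le[OF orthproj_diff_bounded_linear] by (auto simp: s_def)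
  then have s2: "s\<^sup>2 < 1" by (simp add: power_less_one_iff abs_square_less_1)
  have "norm (v - q v) \<le> s * norm v"
    using onorm[OF orthproj_diff_bounded_linear, of v] by (simp add: s_def orthproj_fixes[OF p v])
  then have "(norm (v - q v))\<^sup>2 \<le> s\<^sup>2 * (norm v)\<^sup>2"
    using power_mono[of _ _ 2] by (fastforce simp: power_mult_distrib)
  then have "(sqrt (1 - s\<^sup>2) * norm v)\<^sup>2 \<le> (norm (q v))\<^sup>2"
    using orthproj_pythagoras[OF q, of v] s2 by (simp add: power_mult_distrib algebra_simps)
  then have "sqrt (1 - s\<^sup>2) * norm v \<le> norm (q v)" by (rule power2_le_imp_le) simp
  then show ?thesis using s2 unfolding s_def[symmetric] by (simp add: le_divide_eq mult.commute)
qed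

section \<open>An oblique projection compared with the two orthogonal ones\<close>

context
  fixes P :: "'a \<Rightarrow> 'a"
  assumes P_in: "\<And>x. P x \<in> V" and P_orth: "\<And>x w. w \<in> W \<Longrightarrow> w \<bullet> (x - P x) = 0"
begin

text \<open>
  In the splitting of \<open>norm_orthproj_diff\<close> one summand is \<open>1 - p\<close> applied to a vector of \<open>W\<close> and the
  other is \<open>p\<close> applied to a vector of \<open>W\<^sup>\<bottom>\<close>.  The bound on \<open>P\<close> makes both contract by the same factor:
  \<open>1 - p\<close> contracts on \<open>W\<close> since \<open>p\<close> is bounded below there, and \<open>p\<close> contracts on \<open>W\<^sup>\<bottom>\<close> by duality,
  since \<open>1 - q\<close> contracts on \<open>V\<close>.
\<close>

lemma onorm_orthproj_diff_less_1:
  assumes bounded: "\<And>x. norm (P x) \<le> K * norm x"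
    and trivial: "\<And>v. v \<in> V \<Longrightarrow> (\<And>w. w \<in> W \<Longrightarrow> w \<bullet> v = 0) \<Longrightarrow> v = 0"
  shows "onorm (\<lambda>x. p x - q x) < 1"
proof -
  \<comment> \<open>The maximum ensures \<open>L \<noteq> 0\<close> and \<open>1 - 1 / L\<^sup>2 \<ge> 0\<close>.\<close>
  define L where "L = max 1 K"
  have L: "L \<ge> 1" by (simp add: L_def)
  have PL: "norm (P x) \<le> L * norm x" for x
    using bounded[of x] by (rule order_trans) (simp add: L_def mult_right_mono)
  \<comment> \<open>Since \<open>v - q v\<close> is orthogonal to \<open>W\<close>, \<open>P\<close> maps \<open>q v\<close> back to \<open>v\<close>.\<close>
  have V_bound: "norm v \<le> L * norm (q v)" if v: "v \<in> V" for v
  proof -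
    have "P (q v) - v = 0"
    proof (rule trivial)
      show "P (q v) - v \<in> V" using v P_in orthproj_subspace[OF p] by (simp add: subspace_diff)
      fix w assume w: "w \<in> W"
      show "w \<bullet> (P (q v) - v) = 0"
        using P_orth[OF w, of "q v"] orthproj_orth[OF q w, of v] by (simp add: inner_diff_right)
    qed
    then show ?thesis using PL[of "q v"] by simp
  qed
  \<comment> \<open>The adjoint version: \<open>w \<bullet> x = w \<bullet> P x = p w \<bullet> P x\<close>, used with \<open>x = w\<close>.\<close>
  have W_bound: "norm w \<le> L * norm (p w)" if w: "w \<in> W" for w
  proof (cases "w = 0")
    case False
    have "(norm w)\<^sup>2 = P w \<bullet> w"
      using P_orth[OF w, of w] by (simp add: power2_norm_eq_inner inner_diff_right inner_commute)
    also have "\<dots> = P w \<bullet> p w"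
      using orthproj_orth[OF p P_in, of w w] by (simp add: inner_diff_right)
    also have "\<dots> \<le> norm (P w) * norm (p w)" by (rule norm_cauchy_schwarz)
    also have "\<dots> \<le> (L * norm w) * norm (p w)" by (intro mult_right_mono PL) simp
    finally show ?thesis using False by (simp add: power2_eq_square)
  qed (use L in simp)
  \<comment> \<open>By Pythagoras, a projection that keeps at least \<open>1 / L\<close> of the norm of a vector leaves at most
     \<open>1 - 1 / L\<^sup>2\<close> of its squared norm.\<close>
  define c where "c = 1 - 1 / L\<^sup>2"
  have c: "0 \<le> c" "c < 1" using L by (auto simp: c_def)
  have defect: "(norm (x - r x))\<^sup>2 \<le> c * (norm x)\<^sup>2"
    if "is_orthproj M r" "norm x \<le> L * norm (r x)" for M r and x :: 'a
  proof -
    have "(norm x)\<^sup>2 \<le> L\<^sup>2 * (norm (r x))\<^sup>2"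
      using power_mono[OF that(2), of 2] by (simp add: power_mult_distrib)
    then have "(norm x)\<^sup>2 / L\<^sup>2 \<le> (norm (r x))\<^sup>2"
      using L by (simp add: divide_le_eq mult.commute)
    moreover have "c * (norm x)\<^sup>2 = (norm x)\<^sup>2 - (norm x)\<^sup>2 / L\<^sup>2"
      by (simp add: c_def left_diff_distrib)
    ultimately show ?thesis using orthproj_pythagoras[OF that(1), of x] by linarith
  qed
  have orth_bound: "(norm (p y))\<^sup>2 \<le> c * (norm y)\<^sup>2" if y: "\<And>w. w \<in> W \<Longrightarrow> w \<bullet> y = 0" for y
  proof (cases "p y = 0")
    case False
    have "(norm (p y))\<^sup>2 = p y \<bullet> y"
      using orthproj_orth[OF p orthproj_in[OF p], of y y]
      by (simp add: power2_norm_eq_inner inner_diff_right)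
    also have "\<dots> = (p y - q (p y)) \<bullet> y"
      using y[OF orthproj_in[OF q]] by (simp add: inner_diff_left)
    also have "\<dots> \<le> norm (p y - q (p y)) * norm y" by (rule norm_cauchy_schwarz)
    also have "\<dots> \<le> (sqrt c * norm (p y)) * norm y"
      by (rule mult_right_mono, rule power2_le_imp_le)
         (use defect[OF q V_bound[OF orthproj_in[OF p]], of y] c in \<open>simp_all add: power_mult_distrib\<close>)
    finally have "norm (p y) \<le> sqrt c * norm y" using False by (simp add: power2_eq_square)
    then have "(norm (p y))\<^sup>2 \<le> (sqrt c * norm y)\<^sup>2" by (rule power_mono) simp
    then show ?thesis using c by (simp add: power_mult_distrib)
  qed (use c in simp)
  have "onorm (\<lambda>x. p x - q x) \<le> sqrt c"
  proof (rule onorm_bound)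
    fix x
    have "(norm (p x - q x))\<^sup>2 \<le> c * (norm (x - q x))\<^sup>2 + c * (norm (q x))\<^sup>2"
      unfolding norm_orthproj_diff
      by (intro add_mono orth_bound defect[OF p] W_bound orthproj_orth[OF q] orthproj_in[OF q])
    also have "\<dots> = (sqrt c * norm x)\<^sup>2"
      using orthproj_pythagoras[OF q, of x] c by (simp add: power_mult_distrib algebra_simps)
    finally show "norm (p x - q x) \<le> sqrt c * norm x"
      by (rule power2_le_imp_le) (simp add: c)
  qed (simp add: c)
  also have "\<dots> < 1" using c by simp
  finally show ?thesis .
qed

context
  assumes less1: "onorm (\<lambda>x. p x - q x) < 1"
begin

text \<open>
  Here \<open>v = P x - p x\<close> is the image of \<open>z = x - p x\<close> under the oblique projection, so that
  \<open>q v = q z = - (p - q) z\<close> because \<open>p z = 0\<close>.  This supplies the factor \<open>s\<close> in front of \<open>1 / cos \<theta>\<close>.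
\<close>

lemma norm_oblique_minus_range_orthproj:
  "norm (p x - P x) \<le> tan (arcsin (onorm (\<lambda>x. p x - q x))) * norm x"
proof -
  define s where "s = onorm (\<lambda>x. p x - q x)"
  define z where "z = x - p x"
  define v where "v = P x - p x"
  have v: "v \<in> V" using P_in orthproj_in[OF p] orthproj_subspace[OF p] by (simp add: v_def subspace_diff)
  have "q v = q z"
    by (rule orthproj_cong[OF q, symmetric]) (use P_orth in \<open>simp add: v_def z_def\<close>)
  also have "norm \<dots> \<le> s * norm z"
  proof -
    have "p z = 0"
      by (rule orthproj_unique[OF p])
         (auto simp: z_def orthproj_subspace[OF p] subspace_0 orthproj_orth[OF p])
    then show ?thesis using onorm[OF orthproj_diff_bounded_linear, of z] by (simp add: s_def)
  qed
  also have "\<dots> \<le> s * norm x"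
    using orthproj_norm_le(2)[OF p] onorm_pos_le[OF orthproj_diff_bounded_linear]
    by (simp add: s_def z_def mult_left_mono)
  finally have qv: "norm (q v) \<le> s * norm x" .
  have "norm v \<le> norm (q v) / sqrt (1 - s\<^sup>2)"
    using norm_le_orthproj_div_cos[OF less1 v] by (simp add: s_def)
  also have "\<dots> \<le> s * norm x / sqrt (1 - s\<^sup>2)"
    using onorm_orthproj_diff_le_1 onorm_pos_le[OF orthproj_diff_bounded_linear]
    by (intro divide_right_mono qv) (auto simp: s_def abs_square_le_1)
  finally show ?thesis
    unfolding tan_arcsin_onorm_orthproj_diff[OF less1] by (simp add: s_def v_def norm_minus_commute)
qed

text \<open>
  The vectors \<open>x\<close> and \<open>v = P x\<close> have the same projection to \<open>W\<close>.  The difference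
  \<open>q v - v = - (p - q) v\<close> supplies the factor \<open>s\<close>, and \<open>\<parallel>q v\<parallel> = \<parallel>q x\<parallel> \<le> \<parallel>x\<parallel>\<close> the rest.
\<close>

lemma norm_oblique_minus_kernel_orthproj:
  "norm (q x - P x) \<le> tan (arcsin (onorm (\<lambda>x. p x - q x))) * norm x"
proof -
  define s where "s = onorm (\<lambda>x. p x - q x)"
  have s0: "s \<ge> 0" using onorm_pos_le[OF orthproj_diff_bounded_linear] by (simp add: s_def)
  have qx: "q x = q (P x)" by (rule orthproj_cong[OF q P_orth])
  have "norm (q x - P x) \<le> s * norm (P x)"
    using onorm[OF orthproj_diff_bounded_linear, of "P x"]
    by (simp add: s_def orthproj_fixes[OF p P_in] qx norm_minus_commute)
  also have "\<dots> \<le> s * (norm (q (P x)) / sqrt (1 - s\<^sup>2))"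
    using mult_left_mono[OF norm_le_orthproj_div_cos[OF less1 P_in] s0] by (simp only: s_def)
  also have "\<dots> \<le> s * (norm x / sqrt (1 - s\<^sup>2))"
    using onorm_orthproj_diff_le_1 s0 orthproj_norm_le(1)[OF q, of x]
    by (intro mult_left_mono divide_right_mono) (auto simp: s_def abs_square_le_1 qx)
  finally show ?thesis unfolding tan_arcsin_onorm_orthproj_diff[OF less1] by (simp add: s_def)
qed

end

end

end

section \<open>From complex to real subspaces\<close>

lemma csubspace_imp_subspace: "csubspace M \<Longrightarrow> subspace M"
  by (simp add: complex_vector.subspace_def subspace_def scaleR_scaleC)

text \<open>
  The imaginary part of \<open>cinner y x\<close> is, up to sign, the real part of \<open>cinner (\<i> *\<^sub>C y) x\<close>, and \<open>\<i> *\<^sub>C y\<close>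
  lies in the subspace as well.
\<close>

lemma orthocomplement_csubspace_iff:
  assumes "csubspace M"
  shows "x \<in> orthocomplement M \<longleftrightarrow> (\<forall>y\<in>M. y \<bullet> x = 0)"
proof
  show "\<forall>y\<in>M. y \<bullet> x = 0" if "x \<in> orthocomplement M"
    using that by (simp add: orthocomplement_def inner_Re_cinner)
  assume orth: "\<forall>y\<in>M. y \<bullet> x = 0"
  have "cinner y x = 0" if y: "y \<in> M" for y
  proof -
    have "cinner (\<i> *\<^sub>C y) x = - \<i> * cinner y x"
      by (metis cinner_commute cinner_scaleC_right complex_cnj_i complex_cnj_mult)
    moreover have "\<i> *\<^sub>C y \<in> M" using assms y by (simp add: complex_vector.subspace_scale)
    ultimately have "Im (cinner y x) = 0" using orth by (auto simp: inner_Re_cinner)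
    moreover have "Re (cinner y x) = 0" using orth y by (simp add: inner_Re_cinner)
    ultimately show ?thesis by (simp add: complex_eq_iff)
  qed
  then show "x \<in> orthocomplement M" by (simp add: orthocomplement_def)
qed

lemma orthproj_eq:
  assumes "csubspace M" "is_orthproj M p"
  shows "orthproj M = p"
proof
  fix x
  show "orthproj M x = p x"
    unfolding orthproj_def proj_along_def
  proof (rule the_equality)
    show "p x \<in> M \<and> x - p x \<in> orthocomplement M"
      using orthproj_in[OF assms(2)] orthproj_orth[OF assms(2)]
      by (simp add: orthocomplement_csubspace_iff[OF assms(1)])
    show "v = p x" if "v \<in> M \<and> x - v \<in> orthocomplement M" for v
      using that orthproj_unique[OF assms(2), of v x]
      by (simp add: orthocomplement_csubspace_iff[OF assms(1)])
  qed
qed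

text \<open>
  The complex span of \<open>B\<close> is the real span of \<open>B \<union> \<i> B\<close>; this makes the real Gram-Schmidt process
  applicable.
\<close>

lemma finite_dim_csubspace_real_span:
  assumes "finite_dim_csubspace U"
  obtains B where "finite B" "U = span B"
proof -
  obtain B where B: "finite B" "U = cspan B" "csubspace U"
    using assms by (auto simp: finite_dim_csubspace_def)
  define C where "C = B \<union> (*\<^sub>C) \<i> ` B"
  have "span C \<subseteq> U"
    using B(3) unfolding B(2) C_def
    by (intro span_minimal csubspace_imp_subspace)
       (auto intro: complex_vector.span_base complex_vector.span_scale)
  moreover have "U \<subseteq> span C"
    unfolding B(2)
  proof (rule complex_vector.span_minimal)
    show "B \<subseteq> span C" by (auto simp: C_def intro: span_base)
    have i: "\<i> *\<^sub>C x \<in> span C" if "x \<in> span C" for x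
      using that
    proof (induction rule: span_induct)
      case base
      show ?case
        unfolding subspace_def mem_Collect_eq
      proof (intro conjI ballI allI)
        show "\<i> *\<^sub>C 0 \<in> span C" by (simp add: complex_vector.scale_zero_right span_zero)
        fix x y and r :: real
        assume x: "x \<in> {x. \<i> *\<^sub>C x \<in> span C}"
        have "\<i> *\<^sub>C r *\<^sub>R x = r *\<^sub>R \<i> *\<^sub>C x" by (simp add: scaleR_scaleC scaleC_scaleC mult.commute)
        then show "\<i> *\<^sub>C r *\<^sub>R x \<in> span C" using x by (simp add: span_scale)
        assume "y \<in> {x. \<i> *\<^sub>C x \<in> span C}"
        then show "\<i> *\<^sub>C (x + y) \<in> span C" using x by (simp add: scaleC_add_right span_add)
      qed
    next
      case (step x)
      have ii: "\<i> *\<^sub>C \<i> *\<^sub>C y = - y" for y :: 'a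
        using complex_vector.scale_minus_left[of 1 y] by (simp add: scaleC_scaleC scaleC_one)
      from step consider "x \<in> B" | y where "y \<in> B" "x = \<i> *\<^sub>C y" by (auto simp: C_def)
      then show ?case
      proof cases
        case 1
        then show ?thesis by (auto simp: C_def intro: span_base)
      next
        case 2
        then show ?thesis unfolding 2(2) ii by (auto simp: C_def intro: span_base span_neg)
      qed
    qed
    have decomp: "c *\<^sub>C x = Re c *\<^sub>R x + Im c *\<^sub>R \<i> *\<^sub>C x" for c and x :: 'a
      by (simp add: scaleR_scaleC scaleC_scaleC flip: scaleC_add_left)
         (simp add: mult.commute flip: complex_eq)
    have "c *\<^sub>C x \<in> span C" if "x \<in> span C" for c x
      unfolding decomp[of c x] by (intro span_add span_scale i that)
    then show "csubspace (span C)"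
      by (simp add: complex_vector.subspace_def span_zero span_add)
  qed
  ultimately show ?thesis using that[of C] B(1) by (simp add: C_def)
qed

lemma operator_on_csubspace_image:
  assumes "operator_on U f"
  shows "csubspace (f ` U)"
proof -
  have U: "csubspace U" and add: "\<And>x y. x \<in> U \<Longrightarrow> y \<in> U \<Longrightarrow> f (x + y) = f x + f y"
    and scale: "\<And>c x. x \<in> U \<Longrightarrow> f (c *\<^sub>C x) = c *\<^sub>C f x"
    using assms by (auto simp: operator_on_def)
  have 0: "0 \<in> U" using U by (rule complex_vector.subspace_0)
  have "f 0 = 0" using scale[OF 0, of 0] by (simp add: complex_vector.scale_zero_left)
  then have "0 \<in> f ` U" using 0 by force
  moreover have "f x + f y \<in> f ` U" if "x \<in> U" "y \<in> U" for x y
    using that U add[symmetric] by (simp add: complex_vector.subspace_add)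
  moreover have "c *\<^sub>C f x \<in> f ` U" if "x \<in> U" for c x
    using that U scale[symmetric] by (simp add: complex_vector.subspace_scale)
  ultimately show ?thesis by (auto simp: complex_vector.subspace_def)
qed

section \<open>The self-adjoint operator\<close>

text \<open>
  Density of \<open>D\<close> makes the description of \<open>adjoint_op\<close> unique, so that its defining equation may be
  used with the value \<open>H y\<close>.
\<close>

lemma selfadjoint_symmetric:
  assumes "selfadjoint D H" "x \<in> D" "y \<in> D"
  shows "H x \<bullet> y = x \<bullet> H y"
proof -
  have D: "csubspace D" "closure D = UNIV" "y \<in> adjoint_dom D H" "adjoint_op D H y = H y"
    using assms by (auto simp: selfadjoint_def operator_on_def)
  then obtain z where z: "\<forall>x\<in>D. cinner (H x) y = cinner x z" by (auto simp: adjoint_dom_def)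
  have "adjoint_op D H y = z"
    unfolding adjoint_op_def
  proof (rule the_equality[where a = z])
    fix z' assume z': "\<forall>x\<in>D. cinner (H x) y = cinner x z'"
    have "D \<subseteq> {x. x \<bullet> (z' - z) = 0}"
    proof
      fix x assume "x \<in> D"
      then have "x \<bullet> z' = x \<bullet> z" using z z' by (simp add: inner_Re_cinner)
      then show "x \<in> {x. x \<bullet> (z' - z) = 0}" by (simp add: inner_diff_right)
    qed
    moreover have "closed {x. x \<bullet> (z' - z) = 0}"
      by (intro closed_Collect_eq continuous_intros)
    ultimately have "closure D \<subseteq> {x. x \<bullet> (z' - z) = 0}" by (rule closure_minimal)
    then have "(z' - z) \<bullet> (z' - z) = 0" using D(2) by blast
    then show "z' = z" by simp
  qed (rule z)
  then show ?thesis using z assms(2) D(4) by (simp add: inner_Re_cinner)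
qed

theorem theorem1p4:
  fixes H :: "'a::chilbert_space \<Rightarrow> 'a" and D U V W :: "'a set" and P :: "'a \<Rightarrow> 'a"
  assumes "selfadjoint D H"
    and "has_bounded_inverse D H"
    and "finite_dim_csubspace U" and "U \<subseteq> D"
    and "V = H ` U"
    and "W = inv_into D H ` U"
    and "P = proj_along V (orthocomplement W)"
  shows "onorm (\<lambda>x. orthproj U x - P x)
    \<le> min (sin (max_angle U V)) (sin (max_angle U W)) + tan (max_angle V W)"
proof -
  define G where "G = inv_into D H"
  have bij: "bij_betw H D UNIV" and G_bl: "bounded_linear G"
    using assms(2) by (auto simp: has_bounded_inverse_def G_def)
  have HG: "H (G x) = x" for x
    unfolding G_def by (rule bij_betw_inv_into_right[OF bij]) simp
  have GH: "G (H x) = x" if "x \<in> D" for x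
    unfolding G_def by (rule bij_betw_inv_into_left[OF bij that])
  have GD: "G x \<in> D" for x
    unfolding G_def using bij by (auto simp: bij_betw_def intro: inv_into_into)
  have H_op: "operator_on D H" using assms(1) by (simp add: selfadjoint_def)
  have D: "csubspace D" and H_add: "\<And>x y. x \<in> D \<Longrightarrow> y \<in> D \<Longrightarrow> H (x + y) = H x + H y"
    and H_scale: "\<And>c x. x \<in> D \<Longrightarrow> H (c *\<^sub>C x) = c *\<^sub>C H x"
    using H_op by (auto simp: operator_on_def)
  have U: "csubspace U" using assms(3) by (simp add: finite_dim_csubspace_def)
  have V: "csubspace V"
    unfolding assms(5)
  proof (rule operator_on_csubspace_image)
    have "x \<in> D" if "x \<in> U" for x using that assms(4) by blast
    then show "operator_on U H" using U by (simp add: operator_on_def H_add H_scale)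
  qed
  have "G (c *\<^sub>C x) = c *\<^sub>C G x" for c x
    using GH[of "c *\<^sub>C G x"] D GD by (simp add: H_scale HG complex_vector.subspace_scale)
  then have "operator_on U G"
    using U by (simp add: operator_on_def bounded_linear.linear[OF G_bl] linear_add)
  then have W: "csubspace W"
    unfolding assms(6) G_def by (rule operator_on_csubspace_image)
  have sym: "G x \<bullet> y = x \<bullet> G y" for x y
    using selfadjoint_symmetric[OF assms(1) GD GD, of x y] by (simp add: HG)

  obtain B where B: "finite B" "U = span B"
    using finite_dim_csubspace_real_span[OF assms(3)] by blast
  obtain pU where pU: "is_orthproj U pU"
    using finite_span_orthproj[OF B(1)] unfolding B(2) by blast
  interpret pU: bounded_linear pU by (rule orthproj_bounded_linear[OF pU])
  have pUD: "pU x \<in> D" for x using orthproj_in[OF pU] assms(4) by blast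

  \<comment> \<open>\<open>H\<close> itself is linear only on \<open>D\<close>; composing it with the projection gives a total linear map.\<close>
  define T where "T = (\<lambda>x. H (pU x))"
  have T_lin: "linear T"
    by (rule linearI) (simp_all add: T_def pU.add pU.scaleR H_add pUD, simp add: scaleR_scaleC H_scale pUD)
  have pU': "is_orthproj (span B) pU" using pU B(2) by simp
  have "T (pU x) = T x" for x by (simp add: T_def orthproj_fixes[OF pU orthproj_in[OF pU]])
  then have "bounded_linear T" by (rule bounded_linear_via_finite_span[OF B(1) T_lin pU'])
  then have "bounded_linear (\<lambda>x. T (G x))" using G_bl by (rule bounded_linear_compose)
  then have K: "norm (T (G x)) \<le> onorm (\<lambda>x. T (G x)) * norm x" for x
    by (rule onorm)

  have "V = T ` U" using assms(5) orthproj_fixes[OF pU] by (simp add: T_def)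
  then have "V = span (T ` B)" unfolding B(2) linear_span_image[OF T_lin] .
  then obtain pV where pV: "is_orthproj V pV"
    using finite_span_orthproj[OF finite_imageI[OF B(1)], of T] by blast
  have "W = span (G ` B)"
    unfolding linear_span_image[OF bounded_linear.linear[OF G_bl]] using assms(6) B(2) by (simp add: G_def)
  then obtain pW where pW: "is_orthproj W pW"
    using finite_span_orthproj[OF finite_imageI[OF B(1)], of G] by blast

  \<comment> \<open>\<open>V\<close> meets the orthogonal complement of \<open>W\<close> trivially: for \<open>v = H u\<close> and \<open>w = H\<inverse> u\<close>,
     \<open>w \<bullet> v = u \<bullet> u\<close>.\<close>
  have trivial: "v = 0" if v: "v \<in> V" and orth: "\<And>w. w \<in> W \<Longrightarrow> w \<bullet> v = 0" for v
  proof -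
    obtain u where u: "u \<in> U" "v = H u" using v assms(5) by blast
    have Gv: "G v = u" using u assms(4) GH by blast
    have "G u \<in> W" using u(1) assms(6) by (simp add: G_def)
    then have "u \<bullet> u = 0" using orth sym[of u v] Gv by simp
    then have "G v = 0" using Gv by simp
    then have "H 0 = v" using HG[of v] by simp
    moreover have "H 0 = 0" using HG[of 0] linear_0[OF bounded_linear.linear[OF G_bl]] by simp
    ultimately show ?thesis by simp
  qed
  have TG_in: "T (G x) \<in> V" for x using orthproj_in[OF pU] assms(5) by (simp add: T_def)
  have TG_orth: "w \<bullet> (x - T (G x)) = 0" if w: "w \<in> W" for w x
  proof -
    obtain u where u: "u \<in> U" "w = G u" using w assms(6) by (auto simp: G_def)
    have "w \<bullet> (x - T (G x)) = u \<bullet> (G x - pU (G x))"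
      using u(2) by (simp add: sym linear_diff[OF bounded_linear.linear[OF G_bl]] T_def GH pUD)
    then show ?thesis using orthproj_orth[OF pU u(1)] by simp
  qed
  have "P x = T (G x)" for x
    unfolding assms(7) proj_along_def
  proof (rule the_equality)
    show "T (G x) \<in> V \<and> x - T (G x) \<in> orthocomplement W"
      using TG_in TG_orth by (simp add: orthocomplement_csubspace_iff[OF W])
    fix v assume v: "v \<in> V \<and> x - v \<in> orthocomplement W"
    have "v - T (G x) = 0"
    proof (rule trivial)
      show "v - T (G x) \<in> V" using v TG_in V by (simp add: complex_vector.subspace_diff)
      fix w assume w: "w \<in> W"
      show "w \<bullet> (v - T (G x)) = 0"
        using v w TG_orth[OF w, of x]
        by (simp add: orthocomplement_csubspace_iff[OF W] inner_diff_right)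
    qed
    then show "v = T (G x)" by simp
  qed
  then have P: "P = (\<lambda>x. T (G x))" by (rule ext)

  have less1: "onorm (\<lambda>x. pV x - pW x) < 1"
    by (rule onorm_orthproj_diff_less_1[OF pV pW TG_in TG_orth K trivial])
  have orthproj: "orthproj U = pU" "orthproj V = pV" "orthproj W = pW"
    by (rule orthproj_eq[OF U pU], rule orthproj_eq[OF V pV], rule orthproj_eq[OF W pW])
  define t where "t = tan (max_angle V W)"
  have PV: "norm (pV x - P x) \<le> t * norm x" for x
    unfolding P t_def max_angle_def orthproj
    by (rule norm_oblique_minus_range_orthproj[OF pV pW TG_in TG_orth less1])
  have PW: "norm (pW x - P x) \<le> t * norm x" for x
    unfolding P t_def max_angle_def orthproj
    by (rule norm_oblique_minus_kernel_orthproj[OF pV pW TG_in TG_orth less1])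
  have t: "0 \<le> t"
    unfolding t_def max_angle_def orthproj tan_arcsin_onorm_orthproj_diff[OF pV pW less1]
    using less1 onorm_pos_le[OF orthproj_diff_bounded_linear[OF pV pW]]
    by (simp add: abs_square_le_1)
  have bound: "onorm (\<lambda>x. pU x - P x) \<le> sin (max_angle U M) + t"
    if M: "csubspace M" "is_orthproj M r" and r: "\<And>x. norm (r x - P x) \<le> t * norm x" for M r
  proof -
    have bl: "bounded_linear (\<lambda>x. pU x - r x)" by (rule orthproj_diff_bounded_linear[OF pU M(2)])
    have sin: "sin (max_angle U M) = onorm (\<lambda>x. pU x - r x)"
      unfolding max_angle_def orthproj(1) orthproj_eq[OF M]
      by (rule sin_arcsin_onorm_orthproj_diff[OF pU M(2)])
    show ?thesis
      unfolding sin
    proof (rule onorm_bound)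
      fix x
      have "norm (pU x - P x) \<le> norm (pU x - r x) + norm (r x - P x)"
        using norm_triangle_ineq[of "pU x - r x" "r x - P x"] by simp
      also have "\<dots> \<le> (onorm (\<lambda>x. pU x - r x) + t) * norm x"
        using onorm[OF bl, of x] r[of x] by (simp add: distrib_right)
      finally show "norm (pU x - P x) \<le> (onorm (\<lambda>x. pU x - r x) + t) * norm x" .
    qed (use t onorm_pos_le[OF bl] in simp)
  qed
  have "onorm (\<lambda>x. orthproj U x - P x) \<le> sin (max_angle U V) + tan (max_angle V W)"
    using bound[OF V pV PV] by (simp only: orthproj t_def)
  moreover have "onorm (\<lambda>x. orthproj U x - P x) \<le> sin (max_angle U W) + tan (max_angle V W)"
    using bound[OF W pW PW] by (simp only: orthproj t_def)
  ultimately show ?thesis by (simp add: min_def)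
qed

end
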